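(* Every complete partite graph other than $K_2$ is antimagic.
   Context: All graphs are finite, undirected and simple. A complete partite graph is a graph whose vertex set can be partitioned into $k\ge 2$ nonempty classes such that two vertices are adjacent if and only if they belong to different classes. An antimagic labeling of a graph with $m$ edges and $n$ vertices is a bijection from the set of edges to the integers $\{1,\ldots,m\}$ such that all $n$ vertex sums are pairwise distinct, where a vertex sum is the sum of the labels of all edges incident with that vertex. A graph is called antimagic if it has an antimagic labeling. *)

theory Defs
  imports Complex_Main "HOL-Library.Disjoint_Sets" "HOL-Library.Ramsey"
begin

text \<open>A graph is given by its vertex set and its set of edges, an edge being the two-element
  set of its endpoints; \<open>[V]\<^bsup>2\<^esup>\<close> is the set of all two-element subsets of \<open>V\<close>.\<close>

definition simple_graph :: "'a set \<Rightarrow> 'a set set \<Rightarrow> bool" where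
  "simple_graph V E \<longleftrightarrow> finite V \<and> E \<subseteq> [V]\<^bsup>2\<^esup>"

text \<open>The graph is (isomorphic to) \<open>K\<^sub>n\<close>.\<close>

definition is_complete :: "nat \<Rightarrow> 'a set \<Rightarrow> 'a set set \<Rightarrow> bool" where
  "is_complete n V E \<longleftrightarrow> finite V \<and> card V = n \<and> E = [V]\<^bsup>2\<^esup>"

text \<open>The members of \<open>P\<close> are the classes; \<open>partition_on\<close> requires them to be nonempty.\<close>

definition complete_partite :: "'a set \<Rightarrow> 'a set set \<Rightarrow> bool" where
  "complete_partite V E \<longleftrightarrow> simple_graph V E \<and>
     (\<exists>P. partition_on V P \<and> card P \<ge> 2 \<and>
        (\<forall>u\<in>V. \<forall>v\<in>V. {u, v} \<in> E \<longleftrightarrow> (\<exists>C\<in>P. \<exists>D\<in>P. C \<noteq> D \<and> u \<in> C \<and> v \<in> D)))"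

definition vertex_sum :: "'a set set \<Rightarrow> ('a set \<Rightarrow> nat) \<Rightarrow> 'a \<Rightarrow> nat" where
  "vertex_sum E f v = (\<Sum>e | e \<in> E \<and> v \<in> e. f e)"

definition antimagic_labeling :: "'a set \<Rightarrow> 'a set set \<Rightarrow> ('a set \<Rightarrow> nat) \<Rightarrow> bool" where
  "antimagic_labeling V E f \<longleftrightarrow> bij_betw f E {1..card E} \<and> inj_on (vertex_sum E f) V"

definition antimagic :: "'a set \<Rightarrow> 'a set set \<Rightarrow> bool" where
  "antimagic V E \<longleftrightarrow> (\<exists>f. antimagic_labeling V E f)"

end

theory Submission
  imports Defs
begin

text \<open>Let \<open>A\<close> be a smallest class, with \<open>a\<close> vertices, let \<open>B\<close> be the set of the other \<open>b\<close> vertices,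
  and label the graph \<open>H\<close> induced on \<open>B\<close> arbitrarily by \<open>1,\<dots>,T\<close>. Labeling the remaining edges by
  \<open>T + 1,\<dots>,T + b * a\<close> amounts to filling a table whose rows are the vertices of \<open>B\<close>, ordered by
  their sums in \<open>H\<close>, and whose columns are the vertices of \<open>A\<close>. The row-major filling makes the
  sums increase strictly within \<open>B\<close> and within \<open>A\<close>. With at least three classes we have
  \<open>2 * a \<le> b\<close>, which makes every column sum larger than every vertex sum in \<open>B\<close>. For two
  classes and \<open>3 \<le> a\<close> the column-major filling is used instead: there the row sums lie in an
  interval shorter than the distance between two column sums, so there is at most one
  coincidence of a row sum with a column sum. It is removed by exchanging two vertically
  adjacent entries.\<close>

section \<open>Enumerations and sums of distinct integers\<close>

lemma bij_betw_card_eqI: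
  assumes "inj_on f X" "f ` X \<subseteq> Y" "finite Y" "card X = card Y"
  shows "bij_betw f X Y"
  using assms by (metis bij_betw_def card_image card_subset_eq)

text \<open>Sort a list of the elements by the key \<open>w\<close> and index it. Ties remain, so
  the monotonicity is only weak.\<close>

lemma ex_sorted_enumeration:
  fixes w :: "'a \<Rightarrow> 'b::linorder"
  assumes "finite B"
  obtains \<eta> where "bij_betw \<eta> {..<card B} B" "\<And>i j. i \<le> j \<Longrightarrow> j < card B \<Longrightarrow> w (\<eta> i) \<le> w (\<eta> j)"
proof -
  obtain xs where xs: "set xs = B" "distinct xs"
    using finite_distinct_list[OF assms] by blast
  define ys where "ys = sort_key w xs"
  have ys: "set ys = B" "distinct ys" "sorted (map w ys)"
    using xs by (auto simp: ys_def)
  have len: "length ys = card B"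
    using ys by (metis distinct_card)
  show ?thesis
  proof
    show "bij_betw ((!) ys) {..<card B} B"
      using bij_betw_nth[OF ys(2)] len ys(1) by simp
    show "w (ys ! i) \<le> w (ys ! j)" if "i \<le> j" "j < card B" for i j
      using sorted_nth_mono[OF ys(3), of i j] that len by simp
  qed
qed

text \<open>The extreme case consists of the \<open>card S\<close> largest values \<open>T\<close>,
  \<open>T - 1\<close>, and so on. Doubling and moving the correction term to the left keeps the
  bound within \<open>nat\<close>. It later bounds a vertex sum by the degree of the vertex.\<close>

lemma sum_distinct_upper_bound:
  fixes S :: "nat set"
  assumes "S \<subseteq> {1..T}"
  shows "2 * \<Sum>S + card S * (card S - 1) \<le> 2 * card S * T"
  using assms
proof (induction T arbitrary: S)
  case 0
  then show ?case by auto
next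
  case (Suc T)
  have fin: "finite S"
    using Suc.prems finite_subset by blast
  show ?case
  proof (cases "Suc T \<in> S")
    case True
    define S' where "S' = S - {Suc T}"
    have S': "S' \<subseteq> {1..T}"
      using Suc.prems by (auto simp: S'_def le_Suc_eq)
    have c: "card S = Suc (card S')"
      unfolding S'_def using True fin by (metis card.remove)
    have s: "\<Sum>S = Suc T + \<Sum>S'"
      unfolding S'_def using True fin by (simp add: sum.remove)
    show ?thesis
      using Suc.IH[OF S'] unfolding c s by (cases "card S'") (auto simp: algebra_simps)
  next
    case False
    then have "S \<subseteq> {1..T}"
      using Suc.prems by (auto simp: le_Suc_eq)
    from Suc.IH[OF this] show ?thesis
      by simp
  qed
qed

section \<open>Row-major and column-major tables\<close>

lemma mult_add_unique:
  fixes n :: nat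
  assumes "q * n + r = q' * n + r'" "r < n" "r' < n"
  shows "q = q' \<and> r = r'"
proof -
  have "(r + q * n) div n = (r' + q' * n) div n"
    using assms(1) by (simp add: add.commute)
  then have "q = q'"
    using assms(2,3) by simp
  then show ?thesis
    using assms(1) by simp
qed

text \<open>Division with remainder by \<open>a\<close> recovers the cell from its entry, and the
  interval has as many elements as there are cells. The offset \<open>T\<close> reserves the smaller
  labels for \<open>H\<close>.\<close>

lemma row_major_bij:
  fixes a b T :: nat
  shows "bij_betw (\<lambda>(i, j). T + i * a + j + 1) ({..<b} \<times> {..<a}) {T + 1..T + b * a}"
proof (rule bij_betw_card_eqI)
  show "inj_on (\<lambda>(i, j). T + i * a + j + 1) ({..<b} \<times> {..<a})"
  proof (rule inj_onI)
    fix p q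
    assume "p \<in> {..<b} \<times> {..<a}" "q \<in> {..<b} \<times> {..<a}"
      and "(\<lambda>(i, j). T + i * a + j + 1) p = (\<lambda>(i, j). T + i * a + j + 1) q"
    then show "p = q"
      using mult_add_unique[of "fst p" a "snd p" "fst q" "snd q"]
      by (auto simp: split_beta prod_eq_iff)
  qed
  show "(\<lambda>(i, j). T + i * a + j + 1) ` ({..<b} \<times> {..<a}) \<subseteq> {T + 1..T + b * a}"
  proof (rule image_subsetI)
    fix p
    assume "p \<in> {..<b} \<times> {..<a}"
    moreover from this have "Suc (fst p) * a \<le> b * a"
      by (intro mult_right_mono) auto
    ultimately show "(\<lambda>(i, j). T + i * a + j + 1) p \<in> {T + 1..T + b * a}"
      by (auto simp: split_beta)
  qed
qed simp_all

text \<open>Column \<open>j\<close> occupies the block of \<open>b\<close> consecutive integers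
  after \<open>j * b\<close>. The permutation \<open>\<sigma> j\<close> inside the block makes room
  for exchanging two entries of a column.\<close>

lemma column_major_bij:
  fixes a b :: nat
  assumes \<sigma>: "\<And>j. j < a \<Longrightarrow> bij_betw (\<sigma> j) {..<b} {..<b}"
  shows "bij_betw (\<lambda>(i, j). j * b + \<sigma> j i + 1) ({..<b} \<times> {..<a}) {1..b * a}"
proof (rule bij_betw_card_eqI)
  have \<sigma>': "\<sigma> j i < b" if "i < b" "j < a" for i j
    using \<sigma>[OF that(2)] that(1) by (auto simp: bij_betw_def)
  show "inj_on (\<lambda>(i, j). j * b + \<sigma> j i + 1) ({..<b} \<times> {..<a})"
  proof (rule inj_onI)
    fix p q
    assume pq: "p \<in> {..<b} \<times> {..<a}" "q \<in> {..<b} \<times> {..<a}"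
      and "(\<lambda>(i, j). j * b + \<sigma> j i + 1) p = (\<lambda>(i, j). j * b + \<sigma> j i + 1) q"
    then have "snd p = snd q \<and> \<sigma> (snd p) (fst p) = \<sigma> (snd q) (fst q)"
      using \<sigma>' by (intro mult_add_unique[of _ b]) (auto simp: split_beta)
    then show "p = q"
      using bij_betw_imp_inj_on[OF \<sigma>[of "snd q"]] pq by (auto simp: prod_eq_iff inj_on_def)
  qed
  show "(\<lambda>(i, j). j * b + \<sigma> j i + 1) ` ({..<b} \<times> {..<a}) \<subseteq> {1..b * a}"
  proof (rule image_subsetI)
    fix p
    assume p: "p \<in> {..<b} \<times> {..<a}"
    then have "Suc (snd p) * b \<le> a * b"
      by (intro mult_right_mono) auto
    then show "(\<lambda>(i, j). j * b + \<sigma> j i + 1) p \<in> {1..b * a}"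
      using p \<sigma>'[of "fst p" "snd p"] by (auto simp: split_beta mult.commute)
  qed
qed simp_all

section \<open>From a table to an antimagic labeling\<close>

text \<open>Cell \<open>(i, j)\<close> stands for the edge joining \<open>\<eta> i\<close> and
  \<open>\<xi> j\<close>. A vertex of \<open>A\<close> then receives its column sum, a vertex of
  \<open>B\<close> its row sum plus its sum in \<open>H\<close>. The last three hypotheses separate
  the sums within \<open>B\<close>, within \<open>A\<close> and across.\<close>

lemma join_antimagic:
  fixes A B :: "'a set" and M :: "nat \<times> nat \<Rightarrow> nat"
  assumes disj: "A \<inter> B = {}"
    and HB: "\<And>e. e \<in> H \<Longrightarrow> e \<subseteq> B"
    and E: "E = H \<union> {{u, v} |u v. u \<in> B \<and> v \<in> A}"
    and h: "bij_betw h H {1..T}"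
    and \<eta>: "bij_betw \<eta> {..<b} B" and \<xi>: "bij_betw \<xi> {..<a} A"
    and M: "bij_betw M ({..<b} \<times> {..<a}) {T + 1..T + b * a}"
    and rows: "inj_on (\<lambda>i. vertex_sum H h (\<eta> i) + (\<Sum>j<a. M (i, j))) {..<b}"
    and cols: "inj_on (\<lambda>j. \<Sum>i<b. M (i, j)) {..<a}"
    and rows_cols: "\<And>i j. i < b \<Longrightarrow> j < a \<Longrightarrow>
      vertex_sum H h (\<eta> i) + (\<Sum>j<a. M (i, j)) \<noteq> (\<Sum>i<b. M (i, j))"
  shows "antimagic (A \<union> B) E"
proof -
  define g where "g = (\<lambda>(i, j). {\<eta> i, \<xi> j})"
  define X where "X = {..<b} \<times> {..<a}"
  define K where "K = {{u, v} |u v. u \<in> B \<and> v \<in> A}"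
  have \<eta>B: "\<eta> i \<in> B" if "i < b" for i
    using \<eta> that by (auto simp: bij_betw_def)
  have \<xi>A: "\<xi> j \<in> A" if "j < a" for j
    using \<xi> that by (auto simp: bij_betw_def)
  have \<eta>_eq: "\<eta> i = \<eta> i' \<longleftrightarrow> i = i'" if "i < b" "i' < b" for i i'
    using \<eta> that by (auto simp: bij_betw_def inj_on_def)
  have \<xi>_eq: "\<xi> i = \<xi> i' \<longleftrightarrow> i = i'" if "i < a" "i' < a" for i i'
    using \<xi> that by (auto simp: bij_betw_def inj_on_def)
  have ne: "\<eta> i \<noteq> \<xi> j" if "i < b" "j < a" for i j
    using \<eta>B[OF that(1)] \<xi>A[OF that(2)] disj by auto
  have g_inj: "inj_on g X"
    unfolding inj_on_def g_def X_def
    by (auto simp: doubleton_eq_iff \<eta>_eq \<xi>_eq ne ne[symmetric])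
  have "K = (\<Union>i<b. \<Union>j<a. {{\<eta> i, \<xi> j}})"
    using bij_betw_imp_surj_on[OF \<eta>] bij_betw_imp_surj_on[OF \<xi>] unfolding K_def by blast
  then have gK: "g ` X = K"
    by (auto simp: g_def X_def)
  have HK: "H \<inter> K = {}"
    using HB disj by (auto simp: K_def)
  have gH: "g p \<notin> H" if "p \<in> X" for p
    using gK HK that by blast
  \<comment> \<open>Inverting \<open>g\<close> recovers the cell of an edge outside
    \<open>H\<close>; this is sound because \<open>g\<close> is injective on \<open>X\<close>, its
    two ends being told apart by the disjoint sets \<open>A\<close> and \<open>B\<close>.\<close>
  define f where "f e = (if e \<in> H then h e else M (inv_into X g e))" for e
  have fg: "f {\<eta> i, \<xi> j} = M (i, j)" if "i < b" "j < a" for i j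
  proof -
    have p: "(i, j) \<in> X"
      using that by (simp add: X_def)
    have "f (g (i, j)) = M (i, j)"
      using gH[OF p] inv_into_f_f[OF g_inj p] by (simp add: f_def)
    then show ?thesis by (simp add: g_def)
  qed
  have "bij_betw (M \<circ> inv_into X g) K {T + 1..T + b * a}"
    using bij_betw_trans[OF bij_betw_inv_into M[folded X_def], of g K] g_inj gK
    by (simp add: bij_betw_def)
  then have 1: "bij_betw f K {T + 1..T + b * a}"
    by (rule bij_betw_cong[THEN iffD1, rotated]) (use HK in \<open>auto simp: f_def\<close>)
  have 2: "bij_betw f H {1..T}"
    by (rule bij_betw_cong[THEN iffD1, OF _ h]) (auto simp: f_def)
  have "{1..T} \<union> {T + 1..T + b * a} = {1..T + b * a}"
    by auto
  then have bij: "bij_betw f E {1..T + b * a}"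
    using bij_betw_combine[OF 2 1] E K_def by simp
  then have cE: "card E = T + b * a"
    using bij_betw_same_card by fastforce
  have inc_H: "f e = h e" if "e \<in> H" for e
    using that by (simp add: f_def)
  have finH: "finite H"
    using h bij_betw_finite by blast
  have col: "vertex_sum E f (\<xi> j) = (\<Sum>i<b. M (i, j))" if j: "j < a" for j
  proof -
    have "{e. e \<in> E \<and> \<xi> j \<in> e} = (\<lambda>i. {\<eta> i, \<xi> j}) ` {..<b}"
    proof (rule set_eqI)
      fix e
      \<comment> \<open>Edges of \<open>H\<close> stay inside \<open>B\<close>, so only table edges
        meet a vertex of \<open>A\<close>.\<close>
      have "e \<notin> H" if "\<xi> j \<in> e"
        using that HB \<xi>A[OF j] disj by blast
      then have "e \<in> E \<and> \<xi> j \<in> e \<longleftrightarrow> e \<in> g ` X \<and> \<xi> j \<in> e"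
        using E K_def gK by blast
      also have "\<dots> \<longleftrightarrow> e \<in> (\<lambda>i. {\<eta> i, \<xi> j}) ` {..<b}"
        using j by (auto simp: g_def X_def \<xi>_eq ne ne[symmetric])
      finally show "e \<in> {e. e \<in> E \<and> \<xi> j \<in> e} \<longleftrightarrow> e \<in> (\<lambda>i. {\<eta> i, \<xi> j}) ` {..<b}"
        by simp
    qed
    moreover have "inj_on (\<lambda>i. {\<eta> i, \<xi> j}) {..<b}"
      by (auto simp: inj_on_def doubleton_eq_iff \<eta>_eq)
    ultimately show ?thesis
      unfolding vertex_sum_def by (simp add: sum.reindex fg j)
  qed
  have row: "vertex_sum E f (\<eta> i) = vertex_sum H h (\<eta> i) + (\<Sum>j<a. M (i, j))" if i: "i < b" for i
  proof -
    have "{e. e \<in> E \<and> \<eta> i \<in> e} = {e. e \<in> H \<and> \<eta> i \<in> e} \<union> {e. e \<in> g ` X \<and> \<eta> i \<in> e}"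
      using E K_def gK by blast
    also have "{e. e \<in> g ` X \<and> \<eta> i \<in> e} = (\<lambda>j. {\<eta> i, \<xi> j}) ` {..<a}"
      using i by (auto simp: g_def X_def \<eta>_eq ne ne[symmetric])
    finally have "{e. e \<in> E \<and> \<eta> i \<in> e} = {e. e \<in> H \<and> \<eta> i \<in> e} \<union> (\<lambda>j. {\<eta> i, \<xi> j}) ` {..<a}" .
    moreover have "inj_on (\<lambda>j. {\<eta> i, \<xi> j}) {..<a}"
      by (auto simp: inj_on_def doubleton_eq_iff \<xi>_eq)
    moreover have "{e. e \<in> H \<and> \<eta> i \<in> e} \<inter> (\<lambda>j. {\<eta> i, \<xi> j}) ` {..<a} = {}"
      using gH i by (auto simp: g_def X_def)
    ultimately show ?thesis
      unfolding vertex_sum_def using finH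
      by (simp add: sum.union_disjoint sum.reindex fg i inc_H)
  qed
  have "inj_on (vertex_sum E f) B"
    unfolding bij_betw_imp_surj_on[OF \<eta>, symmetric]
  proof (rule inj_on_imageI)
    show "inj_on (vertex_sum E f \<circ> \<eta>) {..<b}"
      using rows by (rule inj_on_cong[THEN iffD1, rotated]) (simp add: row)
  qed
  moreover have "inj_on (vertex_sum E f) A"
    unfolding bij_betw_imp_surj_on[OF \<xi>, symmetric]
  proof (rule inj_on_imageI)
    show "inj_on (vertex_sum E f \<circ> \<xi>) {..<a}"
      using cols by (rule inj_on_cong[THEN iffD1, rotated]) (simp add: col)
  qed
  moreover have "vertex_sum E f u \<noteq> vertex_sum E f v" if "u \<in> B" "v \<in> A" for u v
    using that row col rows_cols bij_betw_imp_surj_on[OF \<eta>] bij_betw_imp_surj_on[OF \<xi>]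
    by (auto simp: image_iff)
  ultimately have "inj_on (vertex_sum E f) (A \<union> B)"
    unfolding inj_on_def by (metis Un_iff)
  then show ?thesis
    using bij cE unfolding antimagic_def antimagic_labeling_def by auto
qed

section \<open>Row sums below column sums in the row-major table\<close>

text \<open>Gauss's formula, arranged to avoid subtraction and division in
  \<open>nat\<close>.\<close>

lemma double_sum_lessThan: "2 * (\<Sum>j<n::nat. j) + n = n * n"
  by (induction n) auto

text \<open>Here \<open>d\<close> and \<open>w\<close> are meant as the degree and the sum in
  \<open>H\<close> of the vertex of row \<open>i\<close>. The multiples of \<open>T\<close> compare
  by \<open>d + a \<le> b\<close>; the other terms are compared in the worst case
  \<open>i = b - 1\<close>, \<open>j = 0\<close>, using \<open>2 * a \<le> b\<close>.\<close>

lemma row_major_row_less_column: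
  fixes a b d T w :: nat
  assumes "1 \<le> a" "2 * a \<le> b" "a \<le> d" "d + a \<le> b"
    and w: "2 * w + d * (d - 1) \<le> 2 * d * T"
    and i: "i < b"
  shows "w + (\<Sum>j<a. T + i * a + j + 1) < (\<Sum>i<b. T + i * a + j + 1)"
proof -
  have "2 * (\<Sum>j<a. T + i * a + j + 1) = 2 * (a * T) + 2 * (a * a * i) + a * a + a"
    using double_sum_lessThan[of a] unfolding sum.distrib by (simp add: algebra_simps)
  moreover have "2 * (\<Sum>i<b. T + i * a + j + 1) + a * b = 2 * (b * T) + a * b * b + 2 * (b * j) + 2 * b"
    using arg_cong[OF double_sum_lessThan[of b], of "\<lambda>x. x * a"]
    unfolding sum.distrib sum_distrib_right[symmetric] by (simp add: algebra_simps)
  moreover have "d * T + a * T \<le> b * T"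
    using mult_right_mono[OF assms(4), of T] by (simp add: add_mult_distrib)
  moreover have "a * (a - 1) \<le> d * (d - 1)"
    using assms by (intro mult_mono) auto
  moreover have "a * a * i + a * a \<le> a * a * b"
    using mult_left_mono[of "Suc i" b "a * a"] i by simp
  moreover have "a * (a - 1) + a = a * a"
    using assms(1) by (cases a) auto
  \<comment> \<open>This is what remains after the multiples of \<open>T\<close> cancel. With
    \<open>b = 2 * a + t\<close>, only the term \<open>a * t\<close> has the wrong sign, and it is
    absorbed by \<open>a * (a * t)\<close>.\<close>
  moreover have "2 * (a * a * b) + a * b + 2 * a < a * b * b + 2 * b + 2 * (a * a)"
  proof -
    obtain t where t: "b = 2 * a + t"
      using assms le_Suc_ex by blast
    have "a * t \<le> a * (a * t)"
      using assms(1) by simp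
    then have "a * t < 2 * (a * (a * t)) + a * (t * t) + 2 * a + 2 * t"
      using assms(1) by linarith
    then show ?thesis
      unfolding t by (simp add: algebra_simps)
  qed
  moreover have "2 * w + d * (d - 1) \<le> 2 * (d * T)"
    using w by (simp add: mult.assoc)
  ultimately show ?thesis by linarith
qed

section \<open>Tables for complete bipartite graphs\<close>

text \<open>For one or two columns the row-major filling is checked directly. The exchange needs
  \<open>3 \<le> a\<close>: for \<open>a = 2\<close> neighbouring row sums of the column-major
  filling differ by 2, and moving both by one would make them equal.\<close>

lemma bipartite_table:
  fixes a b :: nat
  assumes "1 \<le> a" "a \<le> b" "2 \<le> b"
  obtains M :: "nat \<times> nat \<Rightarrow> nat" where
    "bij_betw M ({..<b} \<times> {..<a}) {1..b * a}"
    "inj_on (\<lambda>i. \<Sum>j<a. M (i, j)) {..<b}"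
    "inj_on (\<lambda>j. \<Sum>i<b. M (i, j)) {..<a}"
    "\<And>i j. i < b \<Longrightarrow> j < a \<Longrightarrow> (\<Sum>j<a. M (i, j)) \<noteq> (\<Sum>i<b. M (i, j))"
proof -
  consider "a = 1" | "a = 2" | "3 \<le> a"
    using assms(1) by linarith
  then show ?thesis
  proof cases
    case 1
    have "i + 1 \<noteq> (\<Sum>i<b. i + 1)" if "i < b" for i
    proof -
      \<comment> \<open>Since \<open>b \<ge> 2\<close> there is a second row, of index 0 or 1, whose
        positive label pushes the total above \<open>i + 1\<close>.\<close>
      have "sum Suc {i, if i = 0 then 1 else 0} \<le> sum Suc {..<b}"
        using that assms by (intro sum_mono2) auto
      then show ?thesis
        by (auto split: if_splits)
    qed
    then show ?thesis
      using row_major_bij[of 0 1 b] 1 by (intro that[of "\<lambda>(i, j). 0 + i * 1 + j + 1"]) (auto simp: inj_on_def)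
  next
    case 2
    have R: "(\<Sum>j<2. 0 + i * 2 + j + 1) = 4 * i + 3" for i :: nat
      by (simp add: numeral_2_eq_2)
    have C: "(\<Sum>i<b. 0 + i * 2 + j + 1) = b * b + b * j" for j :: nat
      by (induction b) (auto simp: algebra_simps)
    \<comment> \<open>The row sums are 3 modulo 4, whereas \<open>b * b + b\<close> is even and a
      square is 0 or 1 modulo 4.\<close>
    have "4 * i + 3 \<noteq> b * b + b * j" if j: "j < 2" for i j
    proof
      assume eq: "4 * i + 3 = b * b + b * j"
      have "j = 0 \<or> j = 1"
        using j by auto
      then show False
      proof
        assume "j = 1"
        then have "even (b * b + b * j)"
          by simp
        then show False
          using eq[symmetric] by simp
      next
        assume "j = 0"
        then have "(b * b) mod 4 = 3"
          using arg_cong[OF eq, of "\<lambda>x. x mod 4"] \<open>j = 0\<close> by simp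
        moreover have "(b mod 4) * (b mod 4) mod 4 = (b * b) mod 4"
          by (simp add: mod_mult_eq)
        moreover have "b mod 4 \<in> {0, 1, 2, 3}"
          by auto
        ultimately show False by auto
      qed
    qed
    then show ?thesis
      using row_major_bij[of 0 2 b] 2 assms R C
      by (intro that[of "\<lambda>(i, j). 0 + i * 2 + j + 1"]) (auto simp: inj_on_def)
  next
    case 3
    \<comment> \<open>\<open>S\<close> is the part of a row sum that comes from the block offsets,
      the same for all rows; \<open>Q\<close> is the part of a column sum that comes from the
      positions within its block. Only column 0 is permuted.\<close>
    define S where "S = (\<Sum>j<a. j * b)"
    define Q where "Q = (\<Sum>i<b. i + 1)"
    define M where "M \<sigma> = (\<lambda>(i, j). j * b + (if j = 0 then \<sigma> i else i) + 1)" for \<sigma> :: "nat \<Rightarrow> nat"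
    have M: "bij_betw (M \<sigma>) ({..<b} \<times> {..<a}) {1..b * a}" if "bij_betw \<sigma> {..<b} {..<b}" for \<sigma>
      unfolding M_def
    proof (rule column_major_bij)
      show "bij_betw (\<lambda>i. if j = 0 then \<sigma> i else i) {..<b} {..<b}" for j :: nat
        using that by (cases "j = 0") (simp_all add: bij_betw_def)
    qed
    have R: "(\<Sum>j<a. M \<sigma> (i, j)) = S + (a - 1) * i + \<sigma> i + a" for \<sigma> i
    proof -
      obtain k where k: "a = Suc k" using 3 by (cases a) auto
      show ?thesis
        unfolding S_def M_def k by (induction k) auto
    qed
    have C: "(\<Sum>i<b. M \<sigma> (i, j)) = j * (b * b) + Q" if \<sigma>: "bij_betw \<sigma> {..<b} {..<b}" for \<sigma> j
    proof -
      have "(\<Sum>i<b. if j = 0 then \<sigma> i else i) = (\<Sum>i<b. i)"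
        using sum.reindex_bij_betw[OF \<sigma>, of "\<lambda>x. x"] by (cases "j = 0") auto
      then show ?thesis
        unfolding M_def Q_def prod.case sum.distrib by simp
    qed
    have cols: "inj_on (\<lambda>j. j * (b * b) + Q) {..<a}"
      using assms by (auto simp: inj_on_def)
    have R0: "S + (a - 1) * i + i + a = S + a * (i + 1)" for i
      using 3 by (cases a) auto
    have id: "bij_betw (\<lambda>i. i) {..<b} {..<b}"
      by (simp add: bij_betw_def)
    show ?thesis
    proof (cases "\<exists>i j. i < b \<and> j < a \<and> S + a * (i + 1) = j * (b * b) + Q")
      case False
      show ?thesis
      proof (intro that[of "M (\<lambda>i. i)"] M id; (simp only: R C[OF id] R0)?)
        show "inj_on (\<lambda>i. S + a * (i + 1)) {..<b}"
          using assms(1) by (simp add: inj_on_def)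
      qed (use False cols in auto)
    next
      case True
      then obtain i0 j0 where i0: "i0 < b" and j0: "j0 < a"
        and eq: "S + a * (i0 + 1) = j0 * (b * b) + Q" by blast
      text \<open>Exchanging the entries of rows \<open>p\<close> and \<open>p + 1\<close> in one column changes these two row sums,
        which differ by \<open>a \<ge> 3\<close>, by one towards each other and preserves all column sums.\<close>
      define p where "p = (if i0 + 1 < b then i0 else i0 - 1)"
      \<comment> \<open>If \<open>i0\<close> is the last row, its predecessor is its partner, which
        exists because \<open>b \<ge> 2\<close>.\<close>
      have p: "p + 1 < b" "i0 = p \<or> i0 = p + 1"
        using i0 assms by (auto simp: p_def)
      define \<sigma> where "\<sigma> = (\<lambda>i. if i = p then p + 1 else if i = p + 1 then p else i)"
      have \<sigma>: "bij_betw \<sigma> {..<b} {..<b}"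
        by (rule bij_betw_byWitness[where f' = \<sigma>]) (use p in \<open>auto simp: \<sigma>_def\<close>)
      \<comment> \<open>\<open>D i\<close> is the signed change of row sum \<open>i\<close> caused
        by the exchange, hence the passage to \<open>int\<close>.\<close>
      define D where "D i = (if i = p then 1 else if i = p + 1 then - 1 else 0 :: int)" for i
      have RD: "int (S + (a - 1) * i + \<sigma> i + a) = int S + int a * (int i + 1) + D i" for i
        using 3 by (cases a) (auto simp: \<sigma>_def D_def algebra_simps)
      have D: "\<bar>D i\<bar> \<le> 1" for i by (simp add: D_def)
      \<comment> \<open>Two values of \<open>D\<close> differ by at most 2, which is less than
        \<open>a\<close>.\<close>
      have small: "k = 0" if "int a * k = d" "\<bar>d\<bar> \<le> 2" for k d
      proof (rule ccontr)
        assume "k \<noteq> 0"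
        then have "int a * 1 \<le> int a * \<bar>k\<bar>"
          by (intro mult_left_mono) auto
        also have "\<dots> = \<bar>d\<bar>"
          using that by (simp add: abs_mult flip: that(1))
        finally show False using that 3 by simp
      qed
      show ?thesis
      proof (intro that[of "M \<sigma>"] M \<sigma>; (simp only: R C[OF \<sigma>])?)
        show "inj_on (\<lambda>i. S + (a - 1) * i + \<sigma> i + a) {..<b}"
        proof (rule inj_onI)
          fix x y
          assume "S + (a - 1) * x + \<sigma> x + a = S + (a - 1) * y + \<sigma> y + a"
          from arg_cong[OF this, of int] have "int a * (int x - int y) = D y - D x"
            unfolding RD by (simp add: algebra_simps)
          then have "int x - int y = 0"
            using D[of x] D[of y] by (intro small) auto
          then show "x = y" by simp
        qed
        show "inj_on (\<lambda>j. j * (b * b) + Q) {..<a}"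
          by (rule cols)
        fix i j
        assume i: "i < b" and j: "j < a"
        show "S + (a - 1) * i + \<sigma> i + a \<noteq> j * (b * b) + Q"
        proof
          assume "S + (a - 1) * i + \<sigma> i + a = j * (b * b) + Q"
          \<comment> \<open>Subtracting the original coincidence from the assumed new one cancels
            \<open>S\<close> and \<open>Q\<close>.\<close>
          from arg_cong[OF this, of int]
          have 1: "int a * (int i - int i0) + D i = int (b * b) * (int j - int j0)"
            using arg_cong[OF eq, of int] unfolding RD by (simp add: algebra_simps)
          \<comment> \<open>As \<open>a \<le> b\<close> and \<open>2 \<le> b\<close>, the left side
            of \<open>1\<close> has absolute value at most \<open>b * (b - 1) + 1 < b * b\<close>,
            while distinct columns differ by at least \<open>b * b\<close>.\<close>
          have "\<bar>int a * (int i - int i0)\<bar> \<le> int b * (int b - 1)"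
            unfolding abs_mult using i i0 assms by (intro mult_mono) auto
          then have "\<bar>int (b * b) * (int j - int j0)\<bar> < int (b * b) * 1"
            using D[of i] 1 assms by (simp add: algebra_simps)
          then have "int j - int j0 = 0"
            unfolding abs_mult using assms by (simp add: mult_less_cancel_left)
          then have 2: "int a * (int i - int i0) = - D i"
            using 1 by simp
          then have "int i - int i0 = 0"
            using D[of i] by (intro small) auto
          then have "D i = 0" "i = i0"
            using 2 by auto
          \<comment> \<open>Row \<open>i0\<close> is one of the two exchanged rows, where
            \<open>D\<close> is 1 or -1.\<close>
          then show False
            using p by (auto simp: D_def split: if_splits)
        qed
      qed
    qed
  qed
qed

section \<open>Classes of a complete partite graph\<close>

text \<open>Disjointness makes the class of a vertex unique, so the adjacency condition on two
  classes collapses to non-membership in the class of \<open>u\<close>.\<close>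

lemma complete_partite_smallest_class:
  assumes "complete_partite V E"
  obtains P A where "finite V" "E \<subseteq> [V]\<^bsup>2\<^esup>" "partition_on V P" "2 \<le> card P" "A \<in> P"
    "\<And>C. C \<in> P \<Longrightarrow> card A \<le> card C"
    "\<And>C u v. C \<in> P \<Longrightarrow> u \<in> C \<Longrightarrow> v \<in> V \<Longrightarrow> {u, v} \<in> E \<longleftrightarrow> v \<notin> C"
proof -
  obtain P where V: "finite V" "E \<subseteq> [V]\<^bsup>2\<^esup>" and P: "partition_on V P" "2 \<le> card P"
    and adj: "\<And>u v. u \<in> V \<Longrightarrow> v \<in> V \<Longrightarrow>
      {u, v} \<in> E \<longleftrightarrow> (\<exists>C\<in>P. \<exists>D\<in>P. C \<noteq> D \<and> u \<in> C \<and> v \<in> D)"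
    using assms unfolding complete_partite_def simple_graph_def by metis
  have adj': "{u, v} \<in> E \<longleftrightarrow> v \<notin> C" if "C \<in> P" "u \<in> C" "v \<in> V" for C u v
  proof -
    from that(3) obtain D where D: "D \<in> P" "v \<in> D"
      using partition_onD1[OF P(1)] by blast
    have uniq: "C' = D'" if "C' \<in> P" "D' \<in> P" "x \<in> C'" "x \<in> D'" for C' D' x
      using partition_onD2[OF P(1)] that by (auto simp: disjoint_def)
    have u: "u \<in> V"
      using that(1,2) partition_onD1[OF P(1)] by blast
    then show ?thesis
      unfolding adj[OF u that(3)] using uniq D that(1,2) by blast
  qed
  have "P \<noteq> {}"
    using P(2) by auto
  then obtain C0 where "C0 \<in> P" by blast
  then obtain A where "A \<in> P" "\<And>C. C \<in> P \<Longrightarrow> card A \<le> card C"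
    using ex_has_least_nat[of "\<lambda>C. C \<in> P" C0 card] by blast
  with V P adj' that show thesis by blast
qed

lemma nsets_2_obtain:
  assumes "e \<in> [V]\<^bsup>2\<^esup>"
  obtains u v where "e = {u, v}" "u \<noteq> v" "u \<in> V" "v \<in> V"
  using assms by (auto simp: nsets_def card_2_iff)

section \<open>The cases of two and of at least three classes\<close>

theorem theorem1p4:
  fixes V :: "'a set" and E :: "'a set set"
  assumes "complete_partite V E"
    and "\<not> is_complete 2 V E"
  shows "antimagic V E"
proof -
  obtain P A where V: "finite V" "E \<subseteq> [V]\<^bsup>2\<^esup>" and P: "partition_on V P" "2 \<le> card P"
    and A: "A \<in> P" and min: "\<And>C. C \<in> P \<Longrightarrow> card A \<le> card C"
    and adj: "\<And>C u v. C \<in> P \<Longrightarrow> u \<in> C \<Longrightarrow> v \<in> V \<Longrightarrow> {u, v} \<in> E \<longleftrightarrow> v \<notin> C"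
    using complete_partite_smallest_class[OF assms(1)] by metis
  have finP: "finite P"
    using P(2) by (intro card_ge_0_finite) simp
  have sub: "C \<subseteq> V" "finite C" "C \<noteq> {}" if "C \<in> P" for C
  proof -
    show "C \<subseteq> V" "C \<noteq> {}"
      using that partition_onD1[OF P(1)] partition_onD3[OF P(1)] by auto
    then show "finite C"
      using V(1) finite_subset by blast
  qed
  have disj: "C \<inter> D = {}" if "C \<in> P" "D \<in> P" "C \<noteq> D" for C D
    using partition_onD2[OF P(1)] that by (auto simp: disjoint_def)
  define B where "B = V - A"
  define H where "H = {e \<in> E. e \<subseteq> B}"
  define a where "a = card A"
  define b where "b = card B"
  have AB: "A \<inter> B = {}" "V = A \<union> B" and finB: "finite B"
    using sub[OF A] V(1) by (auto simp: B_def)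
  have subB: "D \<subseteq> B" if "D \<in> P" "D \<noteq> A" for D
    using sub[OF that(1)] disj[OF that(1) A that(2)] by (auto simp: B_def)
  have a1: "1 \<le> a"
    using sub[OF A] by (simp add: a_def Suc_le_eq card_gt_0_iff)
  \<comment> \<open>\<open>A\<close> is a class, so no edge lies inside it and every pair between
    \<open>B\<close> and \<open>A\<close> is an edge.\<close>
  have E: "E = H \<union> {{u, v} |u v. u \<in> B \<and> v \<in> A}"
  proof (intro equalityI subsetI)
    fix e
    assume e: "e \<in> E"
    then obtain u v where uv: "e = {u, v}" "u \<in> V" "v \<in> V"
      using V(2) nsets_2_obtain by (metis subsetD)
    have ev: "e = {v, u}"
      using uv(1) by auto
    have "u \<in> A \<Longrightarrow> v \<in> B" "v \<in> A \<Longrightarrow> u \<in> B"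
      using adj[OF A _ uv(3)] adj[OF A _ uv(2)] e uv ev by (auto simp: B_def)
    then show "e \<in> H \<union> {{u, v} |u v. u \<in> B \<and> v \<in> A}"
      using e uv ev AB(2) unfolding H_def by blast
  next
    fix e
    assume "e \<in> H \<union> {{u, v} |u v. u \<in> B \<and> v \<in> A}"
    moreover have "{u, v} \<in> E" if "u \<in> B" "v \<in> A" for u v
      using adj[OF A that(2), of u] that(1) by (simp add: B_def insert_commute)
    ultimately show "e \<in> E"
      by (auto simp: H_def)
  qed
  have HB: "e \<subseteq> B" if "e \<in> H" for e
    using that by (simp add: H_def)
  obtain \<xi> where \<xi>: "bij_betw \<xi> {..<a} A"
    using ex_bij_betw_nat_finite[OF sub(2)[OF A]] by (auto simp: a_def atLeast0LessThan)
  have "P \<noteq> {A}"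
    using P(2) by auto
  then obtain D where D: "D \<in> P" "D \<noteq> A"
    using A by blast
  show ?thesis
  proof (cases "P = {A, D}")
    case True
    then have BD: "B = D"
      using partition_onD1[OF P(1)] disj[OF D(1) A D(2)] by (auto simp: B_def)
    have "H = {}"
    proof -
      have "e \<notin> E" if "e \<subseteq> D" for e
      proof
        assume "e \<in> E"
        then obtain u v where "e = {u, v}" "v \<in> V"
          using V(2) nsets_2_obtain by (metis subsetD)
        with adj[OF D(1), of u v] \<open>e \<in> E\<close> that show False by simp
      qed
      then show ?thesis by (auto simp: H_def BD)
    qed
    have ab: "a \<le> b"
      using min[OF D(1)] by (simp add: a_def b_def BD)
    \<comment> \<open>Here the exclusion of \<open>K_2\<close> enters: \<open>b = 1\<close> forces
      \<open>a = 1\<close>.\<close>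
    have "b \<noteq> 1"
    proof
      assume "b = 1"
      moreover from this have "a = 1"
        using ab a1 by simp
      ultimately obtain x y where xy: "A = {x}" "B = {y}"
        unfolding a_def b_def by (metis card_1_singletonE)
      then have "x \<noteq> y" "V = {x, y}"
        using AB by auto
      moreover have "E = {{x, y}}"
        using E \<open>H = {}\<close> xy by auto
      ultimately have "is_complete 2 V E"
        unfolding is_complete_def by (auto simp: nsets_def card_2_iff doubleton_eq_iff)
      then show False
        using assms(2) by simp
    qed
    then have b2: "2 \<le> b"
      using ab a1 by simp
    obtain M :: "nat \<times> nat \<Rightarrow> nat" where M: "bij_betw M ({..<b} \<times> {..<a}) {1..b * a}"
      "inj_on (\<lambda>i. \<Sum>j<a. M (i, j)) {..<b}" "inj_on (\<lambda>j. \<Sum>i<b. M (i, j)) {..<a}"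
      "\<And>i j. i < b \<Longrightarrow> j < a \<Longrightarrow> (\<Sum>j<a. M (i, j)) \<noteq> (\<Sum>i<b. M (i, j))"
      using bipartite_table[OF a1 ab b2] by metis
    obtain \<eta> where \<eta>: "bij_betw \<eta> {..<b} B"
      using ex_bij_betw_nat_finite[OF finB] by (auto simp: b_def atLeast0LessThan)
    \<comment> \<open>With \<open>H\<close> empty, the constant 0 serves as its labeling with
      \<open>T = 0\<close>, and the row sums are the full vertex sums in \<open>B\<close>.\<close>
    have 0: "vertex_sum H (\<lambda>_. 0) v = 0" for v
      by (simp add: vertex_sum_def)
    show ?thesis
      unfolding AB(2)
    proof (rule join_antimagic[OF AB(1) HB E _ \<eta> \<xi>, of "\<lambda>_. 0" 0 M])
      show "bij_betw (\<lambda>_. 0) H {1..0::nat}"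
        using \<open>H = {}\<close> by (simp add: bij_betw_def)
    qed (use M 0 in simp_all)
  next
    case False
    then obtain D' where D': "D' \<in> P" "D' \<noteq> A" "D' \<noteq> D"
      using A D by blast
    define T where "T = card H"
    have "finite E"
      using V finite_subset finite_imp_finite_nsets by blast
    then have "finite H"
      by (simp add: H_def)
    then have "\<exists>h. bij_betw h H {1..T}"
      by (rule finite_same_card_bij) (simp_all add: T_def)
    then obtain h where h: "bij_betw h H {1..T}" ..
    define w where "w = vertex_sum H h"
    obtain \<eta> where \<eta>: "bij_betw \<eta> {..<b} B"
      and mono: "\<And>i j. i \<le> j \<Longrightarrow> j < b \<Longrightarrow> w (\<eta> i) \<le> w (\<eta> j)"
      by (rule ex_sorted_enumeration[OF finB, of w, folded b_def]) blast
    \<comment> \<open>A third class \<open>C'\<close> lies in \<open>B\<close> apart from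
      \<open>C\<close> and has at least \<open>a\<close> elements by minimality of
      \<open>A\<close>.\<close>
    have room: "card C + a \<le> b" if C: "C \<in> P" "C \<noteq> A" for C
    proof -
      obtain C' where C': "C' \<in> P" "C' \<noteq> A" "C' \<noteq> C"
        using D D' by metis
      have "card C + card C' = card (C \<union> C')"
        using disj[OF C'(1) C(1) C'(3)] sub C C' by (subst card_Un_disjoint) auto
      also have "\<dots> \<le> b"
        unfolding b_def using subB C C' finB by (intro card_mono) auto
      finally show ?thesis
        using min[OF C'(1)] by (simp add: a_def)
    qed
    have less: "w (\<eta> i) + (\<Sum>j<a. T + i * a + j + 1) < (\<Sum>i<b. T + i * a + j + 1)"
      if i: "i < b" for i j
    proof -
      define v where "v = \<eta> i"
      have v: "v \<in> B"
        using \<eta> i by (auto simp: bij_betw_def v_def)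
      obtain C where C: "C \<in> P" "v \<in> C"
        using v partition_onD1[OF P(1)] by (auto simp: B_def)
      have CA: "C \<noteq> A"
        using v C by (auto simp: B_def)
      define N where "N = {e. e \<in> H \<and> v \<in> e}"
      \<comment> \<open>Within \<open>B\<close>, the neighbours of \<open>v\<close> are exactly the
        vertices outside its class, so its degree in \<open>H\<close> is
        \<open>b - card C\<close>.\<close>
      have N: "N = (\<lambda>u. {v, u}) ` (B - C)"
      proof (intro equalityI subsetI)
        fix e
        assume "e \<in> N"
        then have e: "e \<in> E" "e \<subseteq> B" "v \<in> e"
          by (auto simp: N_def H_def)
        then obtain x y where xy: "e = {x, y}" "x \<in> V" "y \<in> V"
          using V(2) nsets_2_obtain by (metis subsetD)
        then obtain u where u: "e = {v, u}"
          using e(3) by auto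
        then have "u \<notin> C"
          using adj[OF C, of u] e AB(2) by auto
        then show "e \<in> (\<lambda>u. {v, u}) ` (B - C)"
          using u e(2) by auto
      next
        fix e
        assume "e \<in> (\<lambda>u. {v, u}) ` (B - C)"
        then show "e \<in> N"
          using adj[OF C] v AB(2) by (auto simp: N_def H_def)
      qed
      have "inj_on (\<lambda>u. {v, u}) (B - C)"
        by (auto simp: inj_on_def doubleton_eq_iff)
      then have cN: "card N = b - card C"
        unfolding N b_def using subB[OF C(1) CA] sub[OF C(1)] by (simp add: card_image card_Diff_subset)
      have "inj_on h N"
        using h by (auto simp: N_def bij_betw_def intro: inj_on_subset)
      then have "w v = \<Sum>(h ` N)" "card (h ` N) = card N"
        unfolding w_def vertex_sum_def N_def[symmetric] by (simp_all add: sum.reindex card_image)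
      moreover have "h ` N \<subseteq> {1..T}"
        using h by (auto simp: N_def bij_betw_def)
      ultimately have "2 * w v + card N * (card N - 1) \<le> 2 * card N * T"
        using sum_distinct_upper_bound[of "h ` N" T] by simp
      \<comment> \<open>For \<open>d = b - card C\<close>, \<open>room\<close> gives
        \<open>a \<le> d\<close>, minimality of \<open>A\<close> gives \<open>d + a \<le> b\<close>,
        and both together give \<open>2 * a \<le> b\<close>.\<close>
      then show ?thesis
        unfolding v_def[symmetric] using a1 i room[OF C(1) CA] min[OF C(1)] cN
        by (intro row_major_row_less_column[where d = "card N"]) (auto simp: a_def)
    qed
    \<comment> \<open>The sums in \<open>H\<close> increase weakly by the choice of
      \<open>\<eta>\<close>; the table part increases strictly and so breaks ties.\<close>
    have rows: "strict_mono_on {..<b} (\<lambda>i. w (\<eta> i) + (\<Sum>j<a. T + i * a + j + 1))"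
    proof (rule strict_mono_onI)
      fix i i'
      assume i: "i' \<in> {..<b}" "i < i'"
      have "T + i * a + j + 1 < T + i' * a + j + 1" for j
        using i a1 by simp
      then have "(\<Sum>j<a. T + i * a + j + 1) < (\<Sum>j<a. T + i' * a + j + 1)"
        using a1 by (intro sum_strict_mono) (simp_all add: lessThan_empty_iff)
      then show "w (\<eta> i) + (\<Sum>j<a. T + i * a + j + 1) < w (\<eta> i') + (\<Sum>j<a. T + i' * a + j + 1)"
        using i mono[of i i'] by (intro add_le_less_mono) auto
    qed
    \<comment> \<open>\<open>room\<close> serves here to show that \<open>b\<close> is positive, so
      that the column sums are not empty.\<close>
    have cols: "strict_mono_on {..<a} (\<lambda>j. \<Sum>i<b. T + i * a + j + 1)"
      using room[OF D] a1 by (intro strict_mono_onI sum_strict_mono) (auto simp: lessThan_empty_iff)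
    show ?thesis
      unfolding AB(2)
      using strict_mono_on_imp_inj_on[OF rows] strict_mono_on_imp_inj_on[OF cols] less
      by (intro join_antimagic[OF AB(1) HB E h \<eta> \<xi> row_major_bij])
        (auto simp: w_def dest: less_imp_neq)
  qed
qed

end
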